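(* Let $S=\{x_1,\ldots,x_8\}$ be a GCD closed set of $8$ distinct positive integers. If the LCM matrix $[S]$, i.e. the $8\times 8$ matrix whose $(i,j)$-entry is $\mathrm{lcm}(x_i,x_j)$, is singular, then the poset $(S,\mid)$ (ordered by divisibility) is isomorphic to the meet semilattice $8_{\rm J}$ described in the context.
   Context: A finite set $S$ of positive integers is GCD closed if $\gcd(a,b)\in S$ for all $a,b\in S$. The meet semilattice $8_{\rm J}$ is given by its Hasse diagram on eight elements $b, a_1,a_2,a_3,c_1,c_2,c_3,t$: $b$ is the least element and is covered exactly by $a_1,a_2,a_3$; $c_1$ covers exactly $a_1,a_2$; $c_2$ covers exactly $a_1,a_3$; $c_3$ covers exactly $a_2,a_3$; $t$ is the greatest element and covers exactly $c_1,c_2,c_3$. (Thus $8_{\rm J}$ is the Boolean lattice of all subsets of a $3$-element set ordered by inclusion.) *)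

theory Defs
  imports "Jordan_Normal_Form.Determinant"
begin

definition gcd_closed :: "nat set \<Rightarrow> bool" where
  "gcd_closed S \<longleftrightarrow> (\<forall>a\<in>S. \<forall>b\<in>S. gcd a b \<in> S)"

text \<open>The entries are embedded into the reals. Matrix indices start at 0, so the set
  $S = \{x_1, \dots, x_n\}$ is enumerated as \<open>x 0, \<dots>, x (n - 1)\<close>.\<close>

definition lcm_matrix :: "nat \<Rightarrow> (nat \<Rightarrow> nat) \<Rightarrow> real mat" where
  "lcm_matrix n x = mat n n (\<lambda>(i, j). real (lcm (x i) (x j)))"

definition singular_mat :: "'a :: field mat \<Rightarrow> bool" where
  "singular_mat A \<longleftrightarrow> square_mat A \<and> det A = 0"

definition order_isomorphic ::
    "'a set \<Rightarrow> ('a \<Rightarrow> 'a \<Rightarrow> bool) \<Rightarrow> 'b set \<Rightarrow> ('b \<Rightarrow> 'b \<Rightarrow> bool) \<Rightarrow> bool" where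
  "order_isomorphic A leA B leB \<longleftrightarrow>
     (\<exists>f. bij_betw f A B \<and> (\<forall>u\<in>A. \<forall>v\<in>A. leA u v \<longleftrightarrow> leB (f u) (f v)))"

datatype J8 = J_b | J_a1 | J_a2 | J_a3 | J_c1 | J_c2 | J_c3 | J_t

text \<open>The edges of the Hasse diagram: \<open>J8_covered_by u v\<close> means that \<open>v\<close> covers \<open>u\<close>.\<close>

inductive J8_covered_by :: "J8 \<Rightarrow> J8 \<Rightarrow> bool" where
  "J8_covered_by J_b J_a1"
| "J8_covered_by J_b J_a2"
| "J8_covered_by J_b J_a3"
| "J8_covered_by J_a1 J_c1"
| "J8_covered_by J_a2 J_c1"
| "J8_covered_by J_a1 J_c2"
| "J8_covered_by J_a3 J_c2"
| "J8_covered_by J_a2 J_c3"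
| "J8_covered_by J_a3 J_c3"
| "J8_covered_by J_c1 J_t"
| "J8_covered_by J_c2 J_t"
| "J8_covered_by J_c3 J_t"

definition J8_le :: "J8 \<Rightarrow> J8 \<Rightarrow> bool" where
  "J8_le = J8_covered_by\<^sup>*\<^sup>*"

end

theory Submission
  imports Defs
begin

text \<open>Let \<open>\<psi>\<close> be the function on \<open>S\<close> with \<open>\<Sum>z | z \<in> S \<and> z dvd a. \<psi> z = 1 / a\<close>. Since
  \<open>lcm a b = a * b * (1 / gcd a b)\<close>, the LCM matrix is singular only if \<open>\<psi> t = 0\<close> for some
  \<open>t \<in> S\<close>. Let \<open>Y\<close> be the set of maximal proper divisors of \<open>t\<close> in \<open>S\<close> and \<open>F Y\<close> the sum of \<open>\<psi>\<close>
  over all elements of \<open>S\<close> below \<open>Y\<close>, so that \<open>\<psi> t = 1 / t - F Y\<close>. If the meets of some \<open>y \<in> Y\<close>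
  with the other elements of \<open>Y\<close> have a greatest one, \<open>gcd y v\<close>, then
  \<open>F Y = F (Y - {y}) + 1 / y - 1 / gcd y v\<close>, where \<open>1 / y + 1 / v < 1 / gcd y v\<close> because neither
  of \<open>y\<close>, \<open>v\<close> divides the other. Peeling off elements in this way yields \<open>F Y < 0\<close>, hence
  \<open>\<psi> t > 0\<close>, as soon as \<open>Y\<close> has two elements. A count of the elements below \<open>Y\<close>, at most seven,
  shows that the peeling can only get stuck if \<open>Y\<close> consists of the three coatoms of a cube.\<close>

definition dvd_down :: "nat set \<Rightarrow> nat set \<Rightarrow> nat set" where
  "dvd_down S Y = {z\<in>S. \<exists>y\<in>Y. z dvd y}"

definition dvd_antichain :: "nat set \<Rightarrow> bool" where
  "dvd_antichain Y \<longleftrightarrow> (\<forall>a\<in>Y. \<forall>b\<in>Y. a dvd b \<longrightarrow> a = b)"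

definition peelable :: "nat set \<Rightarrow> nat \<Rightarrow> bool" where
  "peelable Y y \<longleftrightarrow> (\<exists>v\<in>Y - {y}. \<forall>u\<in>Y - {y}. gcd y u dvd gcd y v)"

text \<open>For an antichain \<open>{a, b, c}\<close> this says that the three pairwise meets are pairwise
  incomparable.\<close>

definition cube_coatoms :: "nat \<Rightarrow> nat \<Rightarrow> nat \<Rightarrow> bool" where
  "cube_coatoms a b c \<longleftrightarrow> \<not> gcd a b dvd c \<and> \<not> gcd a c dvd b \<and> \<not> gcd b c dvd a"

section \<open>Meets of numbers that do not divide one another\<close>

text \<open>After division by \<open>g\<close>, the cofactors \<open>u\<close> and \<open>v\<close>
  are distinct and both at least 2, so \<open>(u - 1) * (v - 1) > 1\<close>, which is
  \<open>u + v < u * v\<close>.\<close>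

lemma sum_inverse_less_inverse_gcd:
  fixes a b :: nat
  assumes "a > 0" "b > 0" "\<not> a dvd b" "\<not> b dvd a"
  shows "1 / real a + 1 / real b < 1 / real (gcd a b)"
proof -
  define g where "g = gcd a b"
  have g0: "g > 0" using assms by (simp add: g_def)
  obtain u v where u: "a = g * u" and v: "b = g * v"
    unfolding g_def by (meson dvdE gcd_dvd1 gcd_dvd2)
  have "u \<noteq> 0" "u \<noteq> 1" "v \<noteq> 0" "v \<noteq> 1" "u \<noteq> v"
    using assms u v by auto
  then have "(2 \<le> u \<and> 3 \<le> v) \<or> (3 \<le> u \<and> 2 \<le> v)" by linarith
  then obtain i j where "(u = i + 2 \<and> v = j + 3) \<or> (u = i + 3 \<and> v = j + 2)"
    by (metis add.commute le_Suc_ex)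
  then have "u + v < u * v" by (auto simp: algebra_simps)
  then have uv: "real u + real v < real u * real v"
    by (metis of_nat_add of_nat_less_iff of_nat_mult)
  have "1 / real a + 1 / real b = (1 / real g) * ((real u + real v) / (real u * real v))"
    using g0 \<open>u \<noteq> 0\<close> \<open>v \<noteq> 0\<close> by (simp add: u v field_simps)
  also have "\<dots> < (1 / real g) * 1"
    using g0 uv \<open>u \<noteq> 0\<close> \<open>v \<noteq> 0\<close> by (intro mult_strict_left_mono) auto
  finally show ?thesis by (simp add: g_def)
qed

text \<open>The numerically largest meet \<open>gcd y v\<close> properly divides no other meet. As
  it is not a multiple of all of them, some meet is incomparable with it.\<close>

lemma not_peelableE:
  assumes "finite Y" "0 \<notin> Y" "\<not> peelable Y y" "Y - {y} \<noteq> {}"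
  obtains u v where "u \<in> Y - {y}" "v \<in> Y - {y}"
    "\<not> gcd y u dvd gcd y v" "\<not> gcd y v dvd gcd y u"
proof -
  let ?G = "gcd y ` (Y - {y})"
  have "Max ?G \<in> ?G" using assms by (intro Max_in) auto
  then obtain v where v: "v \<in> Y - {y}" "Max ?G = gcd y v" by auto
  then obtain u where u: "u \<in> Y - {y}" "\<not> gcd y u dvd gcd y v"
    using assms(3) unfolding peelable_def by blast
  have "gcd y u \<le> gcd y v"
    using assms(1) u(1) by (simp flip: v(2))
  moreover have "gcd y u > 0"
    using u(1) assms(2) by (metis DiffD1 gcd_pos_nat gr0I)
  ultimately have "\<not> gcd y v dvd gcd y u"
    using u(2) by (metis dvd_imp_le dvd_refl le_antisym)
  with u v that show ?thesis by blast
qed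

section \<open>Divisor sums and peeling in a GCD closed set\<close>

text \<open>The assumption on \<open>psi\<close> makes it the Moebius inverse of
  \<open>1 / a\<close> on the poset \<open>S\<close> under divisibility.\<close>

locale gcd_closed_set =
  fixes S :: "nat set" and psi :: "nat \<Rightarrow> real"
  assumes finS: "finite S"
    and pos: "a \<in> S \<Longrightarrow> a > 0"
    and gcd_in: "a \<in> S \<Longrightarrow> b \<in> S \<Longrightarrow> gcd a b \<in> S"
    and psi: "a \<in> S \<Longrightarrow> sum psi {z\<in>S. z dvd a} = 1 / real a"
begin

lemma finite_dvd_down [simp]: "finite (dvd_down S Y)"
  using finS by (simp add: dvd_down_def)

text \<open>Inclusion-exclusion: the divisors of \<open>y\<close> meet the part below
  \<open>Y - {y}\<close> exactly in the divisors of \<open>gcd y v\<close>, since every other meet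
  divides this one.\<close>

lemma sum_dvd_down_peel:
  assumes "Y \<subseteq> S" "y \<in> Y" "v \<in> Y - {y}" "\<And>u. u \<in> Y - {y} \<Longrightarrow> gcd y u dvd gcd y v"
  shows "sum psi (dvd_down S Y)
    = sum psi (dvd_down S (Y - {y})) + 1 / real y - 1 / real (gcd y v)"
proof -
  let ?A = "dvd_down S (Y - {y})" and ?B = "{z\<in>S. z dvd y}"
  have "dvd_down S Y = ?A \<union> ?B"
    using assms(2) by (auto simp: dvd_down_def)
  moreover have "?A \<inter> ?B = {z\<in>S. z dvd gcd y v}"
  proof -
    have "z dvd gcd y v" if "z dvd y" "z dvd u" "u \<in> Y - {y}" for z u
      using that assms(4)[of u] by (meson dvd_trans gcd_greatest)
    then show ?thesis using assms(3) by (auto simp: dvd_down_def)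
  qed
  moreover have "sum psi (?A \<union> ?B) + sum psi (?A \<inter> ?B) = sum psi ?A + sum psi ?B"
    using finS by (intro sum.union_inter) auto
  moreover have "sum psi ?B = 1 / real y" using assms by (auto intro!: psi)
  moreover have "sum psi {z\<in>S. z dvd gcd y v} = 1 / real (gcd y v)"
    using assms by (intro psi gcd_in) auto
  ultimately show ?thesis by simp
qed

text \<open>The count of seven has two uses: it rules out a cube when at most six elements lie
  below, and it exhausts \<open>S\<close> up to the top element.\<close>

lemma cube_subset_dvd_down:
  assumes "{a, b, c} \<subseteq> S" "dvd_antichain {a, b, c}" "distinct [a, b, c]" "cube_coatoms a b c"
  defines "T \<equiv> [a, b, c, gcd a b, gcd a c, gcd b c, gcd (gcd a b) c]"
  shows "distinct T" "set T \<subseteq> dvd_down S {a, b, c}"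
proof -
  have nd: "\<not> a dvd b" "\<not> a dvd c" "\<not> b dvd a" "\<not> b dvd c" "\<not> c dvd a" "\<not> c dvd b"
    using assms(2,3) by (auto simp: dvd_antichain_def)
  have nd2: "\<not> gcd a b dvd c" "\<not> gcd a c dvd b" "\<not> gcd b c dvd a"
    using assms(4) by (simp_all add: cube_coatoms_def)
  have ne: "gcd u v \<noteq> w" "w \<noteq> gcd u v" if "\<not> w dvd u \<or> \<not> w dvd v" for u v w :: nat
    using that by auto
  have "gcd a b \<noteq> gcd a c" "gcd a b \<noteq> gcd b c" "gcd a c \<noteq> gcd b c"
    using nd2 by (metis gcd_dvd1 gcd_dvd2)+
  then show "distinct T"
    using assms(3) nd nd2 by (simp add: T_def ne)
  show "set T \<subseteq> dvd_down S {a, b, c}"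
    using assms(1) dvd_trans[OF gcd_dvd1 gcd_dvd1, of a b c]
    by (simp add: T_def dvd_down_def gcd_in)
qed

text \<open>If no element can be peeled, \<open>a\<close> has two incomparable meets, which together
  with their gcd are three elements outside \<open>Y\<close>. The meets of \<open>b\<close> supply a
  fourth, so the bound 7 leaves at most three elements for \<open>Y\<close>.\<close>

lemma peelable_or_cube:
  assumes "Y \<subseteq> S" "dvd_antichain Y" "card Y \<ge> 2" "card (dvd_down S Y) \<le> 7"
    and bad: "\<And>y. y \<in> Y \<Longrightarrow> \<not> peelable Y y"
  shows "\<exists>a b c. Y = {a, b, c} \<and> distinct [a, b, c] \<and> cube_coatoms a b c"
proof -
  have finY: "finite Y" using assms(1) finS finite_subset by blast
  have incomp: "\<exists>u\<in>Y - {y}. \<exists>v\<in>Y - {y}. \<not> gcd y u dvd gcd y v \<and> \<not> gcd y v dvd gcd y u"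
    if "y \<in> Y" for y
  proof -
    have "Y - {y} \<noteq> {}"
    proof
      assume "Y - {y} = {}"
      with that have "Y = {y}" by blast
      with assms(3) show False by simp
    qed
    have "0 \<notin> Y" using assms(1) pos by blast
    with \<open>Y - {y} \<noteq> {}\<close> not_peelableE[OF finY _ bad[OF that]] show ?thesis by metis
  qed
  have YD: "Y \<subseteq> dvd_down S Y" using assms(1) dvd_refl unfolding dvd_down_def by blast
  have meetD: "gcd u v \<in> dvd_down S Y" if "u \<in> Y" "v \<in> Y" for u v
    using that assms(1) gcd_in gcd_dvd1 unfolding dvd_down_def by blast
  have below: "z \<notin> Y" if "z dvd u" "z dvd v" "u \<in> Y" "v \<in> Y" "u \<noteq> v" for z u v
    using that assms(2) unfolding dvd_antichain_def by metis
  have "Y \<noteq> {}" using assms(3) by auto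
  then obtain a where a: "a \<in> Y" by blast
  obtain b c where b: "b \<in> Y - {a}" and c: "c \<in> Y - {a}"
    and ni: "\<not> gcd a b dvd gcd a c" "\<not> gcd a c dvd gcd a b"
    using incomp[OF a] by blast
  let ?p = "gcd a b" and ?q = "gcd a c"
  let ?r = "gcd ?p ?q"
  have bc: "b \<noteq> c" using ni by auto
  have ra: "?r dvd a" and rb: "?r dvd b"
    by (meson dvd_trans gcd_dvd1 gcd_dvd2)+
  have pY: "?p \<notin> Y" "?q \<notin> Y" "?r \<notin> Y"
    using a b c below[of ?p a b] below[of ?q a c] below[OF ra rb] by auto
  have rne: "?p \<noteq> ?q" "?p \<noteq> ?r" "?q \<noteq> ?r"
    using ni dvd_refl gcd_dvd1[of ?p ?q] gcd_dvd2[of ?p ?q] by metis+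
  have rD: "?r \<in> dvd_down S Y"
  proof -
    have "?r \<in> S" using a b c assms(1) by (intro gcd_in) auto
    then show ?thesis using a ra unfolding dvd_down_def by blast
  qed
  \<comment> \<open>The witness is one of two incomparable meets of \<open>b\<close>. Neither equals
    \<open>?q\<close>, which does not divide \<open>b\<close>, and they cannot both lie in
    \<open>{?p, ?r}\<close>, because \<open>?r\<close> divides \<open>?p\<close>.\<close>
  obtain s where s: "s \<in> dvd_down S Y" "s \<notin> Y" "s \<noteq> ?p" "s \<noteq> ?q" "s \<noteq> ?r"
  proof -
    obtain u v where u: "u \<in> Y - {b}" and v: "v \<in> Y - {b}"
      and nb: "\<not> gcd b u dvd gcd b v" "\<not> gcd b v dvd gcd b u"
      using incomp[of b] b by blast
    have nq: "gcd b w \<noteq> ?q" for w using ni(2) by (metis gcd_dvd1 gcd_greatest)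
    have rp: "?r dvd ?p" by (rule gcd_dvd1)
    have "gcd b u \<notin> {?p, ?q, ?r} \<or> gcd b v \<notin> {?p, ?q, ?r}"
      using nb nq[of u] nq[of v] rp by (metis dvd_refl insertE singletonD)
    moreover have "gcd b u \<notin> Y" "gcd b v \<notin> Y"
      using u v b below[of "gcd b u" b u] below[of "gcd b v" b v] by auto
    moreover have "gcd b u \<in> dvd_down S Y" "gcd b v \<in> dvd_down S Y"
      using u v b meetD by blast+
    ultimately show ?thesis using that by blast
  qed
  have "card (Y \<union> {?p, ?q, ?r, s}) \<le> 7"
    using YD a b c rD s(1) meetD by (intro order_trans[OF card_mono assms(4)]) auto
  moreover have "card (Y \<union> {?p, ?q, ?r, s}) = card Y + card {?p, ?q, ?r, s}"
    using finY pY s by (intro card_Un_disjoint) auto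
  moreover have "card {?p, ?q, ?r, s} = 4" using s(3,4,5) rne by auto
  ultimately have "card Y \<le> 3" by simp
  moreover have "card {a, b, c} = 3" "{a, b, c} \<subseteq> Y" using a b c bc by auto
  ultimately have Y: "Y = {a, b, c}" using finY by (metis card_seteq)
  \<comment> \<open>Only \<open>a\<close> and \<open>c\<close> remain as partners of
    \<open>b\<close>, so the two incomparable meets of \<open>b\<close> are those with
    \<open>a\<close> and \<open>c\<close>. This gives the last of the three cube conditions.\<close>
  have "b \<in> Y" using b by auto
  from incomp[OF this] b bc have "\<not> gcd b c dvd gcd b a"
    by (auto simp: Y)
  then have "\<not> gcd b c dvd a" by simp
  with ni have "cube_coatoms a b c" by (simp add: cube_coatoms_def)
  with Y b c bc show ?thesis by auto
qed

text \<open>Induction on \<open>card Y\<close>, peeling one element at a time. A cube can occur only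
  before the first peeling, since \<open>y\<close> itself then leaves the set of elements
  below.\<close>

lemma sum_dvd_down_neg_or_cube:
  assumes "Y \<subseteq> S" "dvd_antichain Y" "card Y \<ge> 2" "card (dvd_down S Y) \<le> 7"
  shows "sum psi (dvd_down S Y) < 0
    \<or> (\<exists>a b c. Y = {a, b, c} \<and> distinct [a, b, c] \<and> cube_coatoms a b c)"
  using assms
proof (induction "card Y" arbitrary: Y rule: less_induct)
  case less
  have finY: "finite Y" using less.prems(1) finS finite_subset by blast
  show ?case
  proof (cases "\<exists>y\<in>Y. peelable Y y")
    case False
    then show ?thesis using peelable_or_cube[OF less.prems] by blast
  next
    case True
    then obtain y v where y: "y \<in> Y" and v: "v \<in> Y - {y}"
      and max: "\<And>u. u \<in> Y - {y} \<Longrightarrow> gcd y u dvd gcd y v"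
      unfolding peelable_def by blast
    have "\<not> y dvd v" "\<not> v dvd y"
      using y v less.prems(2) by (auto simp: dvd_antichain_def)
    then have g: "1 / real y + 1 / real v < 1 / real (gcd y v)"
      using y v less.prems(1) by (intro sum_inverse_less_inverse_gcd pos) auto
    note peel = sum_dvd_down_peel[OF less.prems(1) y v max]
    have cy: "card (Y - {y}) = card Y - 1" using y finY by simp
    show ?thesis
    proof (cases "card Y = 2")
      case True
      then have "card (Y - {y}) = 1" using cy by simp
      then have "Y - {y} = {v}" using v by (metis card_1_singletonE singletonD)
      then have "sum psi (dvd_down S (Y - {y})) = 1 / real v"
        using psi[of v] v less.prems(1) by (auto simp: dvd_down_def)
      then show ?thesis using g peel by simp
    next
      case False
      let ?Z = "Y - {y}"
      have "y \<notin> dvd_down S ?Z"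
        using y less.prems(2) by (auto simp: dvd_down_def dvd_antichain_def)
      moreover have "y \<in> dvd_down S Y" "dvd_down S ?Z \<subseteq> dvd_down S Y"
        using y less.prems(1) dvd_refl unfolding dvd_down_def by blast+
      ultimately have "card (dvd_down S ?Z) < card (dvd_down S Y)"
        by (intro psubset_card_mono) auto
      then have c6: "card (dvd_down S ?Z) \<le> 6" using less.prems(4) by simp
      have Z: "?Z \<subseteq> S" "dvd_antichain ?Z"
        using less.prems by (auto simp: dvd_antichain_def)
      have "\<not> (\<exists>a b c. ?Z = {a, b, c} \<and> distinct [a, b, c] \<and> cube_coatoms a b c)"
      proof (intro notI, elim exE conjE)
        fix a b c
        assume abc: "?Z = {a, b, c}" "distinct [a, b, c]" "cube_coatoms a b c"
        note cube = cube_subset_dvd_down[OF Z[unfolded abc(1)] abc(2,3)]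
        have "7 = card (set [a, b, c, gcd a b, gcd a c, gcd b c, gcd (gcd a b) c])"
          unfolding distinct_card[OF cube(1)] by simp
        also have "\<dots> \<le> card (dvd_down S ?Z)"
          unfolding abc(1) by (intro card_mono cube(2)) simp
        finally show False using c6 by simp
      qed
      moreover have "card ?Z < card Y" "card ?Z \<ge> 2"
        using cy False less.prems(3) by auto
      ultimately have "sum psi (dvd_down S ?Z) < 0"
        using less.hyps[of ?Z] Z c6 by fastforce
      \<comment> \<open>By \<open>g\<close>, the peeled contribution
        \<open>1 / y - 1 / gcd y v\<close> is less than \<open>- 1 / v\<close>, hence
        negative.\<close>
      moreover have "1 / real v \<ge> 0" by simp
      ultimately have "sum psi (dvd_down S Y) < 0" using g peel by linarith
      then show ?thesis ..
    qed
  qed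
qed

text \<open>If \<open>psi x = 0\<close>, the sum of \<open>psi\<close> over the proper divisors of
  \<open>x\<close> in \<open>S\<close> is \<open>1 / x\<close>. This is positive, so only the cube
  alternative survives.\<close>

lemma psi_eq_0_imp_cube:
  assumes x: "x \<in> S" "psi x = 0" and "card S \<le> 8"
  obtains a b c where "distinct [a, b, c]" "dvd_antichain {a, b, c}" "cube_coatoms a b c"
    "S = set [x, a, b, c, gcd a b, gcd a c, gcd b c, gcd (gcd a b) c]"
    "a dvd x" "b dvd x" "c dvd x" "\<not> x dvd a" "\<not> x dvd b" "\<not> x dvd c"
proof -
  define D where "D = {z\<in>S. z dvd x} - {x}"
  define Y where "Y = {y\<in>D. \<forall>z\<in>D. y dvd z \<longrightarrow> y = z}"
  have finD: "finite D" using finS by (simp add: D_def)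
  have "sum psi {z\<in>S. z dvd x} = psi x + sum psi D"
    unfolding D_def using x finS by (intro sum.remove) auto
  then have sumD: "sum psi D = 1 / real x" using psi[OF x(1)] x(2) by simp
  have "card D < card S"
    using x finS by (intro psubset_card_mono) (auto simp: D_def)
  then have cD: "card D \<le> 7" using assms(3) by simp
  have YS: "Y \<subseteq> S" by (auto simp: Y_def D_def)
  have ac: "dvd_antichain Y" by (auto simp: Y_def dvd_antichain_def)
  have YD: "dvd_down S Y = D"
  proof (intro equalityI subsetI)
    fix z assume "z \<in> dvd_down S Y"
    then obtain y where "z \<in> S" "z dvd y" "y dvd x" "y \<noteq> x"
      by (auto simp: dvd_down_def Y_def D_def)
    then show "z \<in> D" by (auto simp: D_def dest: dvd_antisym intro: dvd_trans)
  next
    fix z assume z: "z \<in> D"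
    \<comment> \<open>The numerically largest multiple of \<open>z\<close> in \<open>D\<close> is
      also maximal for divisibility.\<close>
    let ?U = "{y\<in>D. z dvd y}"
    have "finite ?U" "?U \<noteq> {}" using finD z by auto
    then have m: "Max ?U \<in> ?U" "\<And>u. u \<in> ?U \<Longrightarrow> u \<le> Max ?U"
      using Max_in by (blast, simp)
    have "Max ?U \<in> Y"
      unfolding Y_def
    proof (intro CollectI conjI ballI impI)
      show "Max ?U \<in> D" using m(1) by blast
      fix w assume w: "w \<in> D" "Max ?U dvd w"
      then have "w \<in> ?U" using m(1) by (auto intro: dvd_trans)
      moreover have "w > 0" using w pos by (auto simp: D_def)
      ultimately show "Max ?U = w"
        using m(2) w(2) by (metis dvd_imp_le le_antisym)
    qed
    then show "z \<in> dvd_down S Y" using z m(1) by (auto simp: dvd_down_def D_def)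
  qed
  \<comment> \<open>An empty \<open>D\<close> would give \<open>1 / x = 0\<close>, and a single
    maximal element \<open>y\<close> would give \<open>1 / y = 1 / x\<close> although
    \<open>y\<close> differs from \<open>x\<close>.\<close>
  have "card Y \<ge> 2"
  proof (rule ccontr)
    assume "\<not> 2 \<le> card Y"
    then consider "card Y = 0" | "card Y = 1" by linarith
    then show False
    proof cases
      case 1
      then have "Y = {}" using YS finS by (metis card_eq_0_iff finite_subset)
      then have "D = {}" using YD by (auto simp: dvd_down_def)
      then show False using sumD pos[OF x(1)] by simp
    next
      case 2
      then obtain y where Y: "Y = {y}" by (metis card_1_singletonE)
      then have "y \<in> S" "y \<noteq> x" by (auto simp: Y_def D_def)
      moreover have "sum psi D = 1 / real y"
        using psi[OF \<open>y \<in> S\<close>] Y by (simp flip: YD add: dvd_down_def)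
      ultimately show False using sumD pos[of y] pos[OF x(1)] by simp
    qed
  qed
  moreover have "\<not> sum psi (dvd_down S Y) < 0" by (simp add: YD sumD)
  ultimately obtain a b c where abc: "Y = {a, b, c}" "distinct [a, b, c]" "cube_coatoms a b c"
    using sum_dvd_down_neg_or_cube[OF YS ac] cD YD by auto
  let ?T = "[a, b, c, gcd a b, gcd a c, gcd b c, gcd (gcd a b) c]"
  note cube = cube_subset_dvd_down[OF YS[unfolded abc(1)] ac[unfolded abc(1)] abc(2,3)]
  have TD: "set ?T \<subseteq> D" using cube(2) abc(1) YD by simp
  have "x \<notin> set ?T" using TD by (auto simp: D_def)
  then have "card (insert x (set ?T)) = 8"
    using distinct_card[OF cube(1)] by (subst card_insert_disjoint) auto
  moreover have "insert x (set ?T) \<subseteq> S" using TD x(1) by (auto simp: D_def)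
  ultimately have "S = insert x (set ?T)"
    using card_seteq[OF finS] assms(3) by metis
  then have "S = set (x # ?T)" by simp
  moreover have "u dvd x \<and> \<not> x dvd u" if "u \<in> Y" for u
    using that by (auto simp: Y_def D_def dest: dvd_antisym)
  ultimately show ?thesis using that[of a b c] abc ac by auto
qed

section \<open>From a singular LCM matrix to a zero of \<open>psi\<close>\<close>

text \<open>The matrix with entries \<open>1 / gcd a b\<close> factors as
  \<open>E * diag psi * E^T\<close>, where \<open>E\<close> is the unitriangular incidence matrix of
  divisibility. With \<open>W\<close> as \<open>E^T\<close> applied to \<open>w\<close>, induction
  upwards gives \<open>W = 0\<close>, and induction downwards then gives
  \<open>w = 0\<close>.\<close>

lemma zero_vector_if_psi_nonzero:
  assumes "\<And>z. z \<in> S \<Longrightarrow> psi z \<noteq> 0"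
    and w: "\<And>a. a \<in> S \<Longrightarrow> (\<Sum>b\<in>S. w b / real (gcd a b)) = 0"
    and "a \<in> S"
  shows "w a = 0"
proof -
  define W where "W z = (\<Sum>b | b \<in> S \<and> z dvd b. w b)" for z
  have *: "(\<Sum>z | z \<in> S \<and> z dvd a. psi z * W z) = 0" if "a \<in> S" for a
  proof -
    have "(\<Sum>z | z \<in> S \<and> z dvd a. psi z * W z)
      = (\<Sum>z | z \<in> S \<and> z dvd a. \<Sum>b | b \<in> S \<and> z dvd b. psi z * w b)"
      by (simp add: W_def sum_distrib_left)
    also have "\<dots> = (\<Sum>b\<in>S. \<Sum>z | z \<in> {z\<in>S. z dvd a} \<and> z dvd b. psi z * w b)"
      using finS by (subst sum.swap_restrict) auto
    also have "\<dots> = (\<Sum>b\<in>S. w b / real (gcd a b))"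
    proof (intro sum.cong refl)
      fix b assume "b \<in> S"
      have "(\<Sum>z | z \<in> {z\<in>S. z dvd a} \<and> z dvd b. psi z * w b)
        = sum psi {z\<in>S. z dvd gcd a b} * w b"
        by (simp add: sum_distrib_right conj_assoc)
      then show "(\<Sum>z | z \<in> {z\<in>S. z dvd a} \<and> z dvd b. psi z * w b) = w b / real (gcd a b)"
        using psi[OF gcd_in[OF that \<open>b \<in> S\<close>]] by simp
    qed
    finally show ?thesis using w[OF that] by simp
  qed
  have W0: "W z = 0" if "z \<in> S" for z
    using that
  proof (induction z rule: less_induct)
    case (less z)
    have "(\<Sum>y | y \<in> S \<and> y dvd z. psi y * W y) =
      psi z * W z + (\<Sum>y\<in>{y. y \<in> S \<and> y dvd z} - {z}. psi y * W y)"
      using less.prems finS by (intro sum.remove) auto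
    also have "(\<Sum>y\<in>{y. y \<in> S \<and> y dvd z} - {z}. psi y * W y) = 0"
      using less pos[OF less.prems] by (intro sum.neutral) (auto dest!: dvd_imp_le)
    finally show ?case using *[OF less.prems] assms(1)[OF less.prems] by simp
  qed
  show ?thesis
    using assms(3)
  proof (induction "Max S - a" arbitrary: a rule: less_induct)
    case less
    have "W a = w a + (\<Sum>b\<in>{b. b \<in> S \<and> a dvd b} - {a}. w b)"
      unfolding W_def using less.prems finS by (intro sum.remove) auto
    also have "(\<Sum>b\<in>{b. b \<in> S \<and> a dvd b} - {a}. w b) = 0"
    proof (intro sum.neutral ballI)
      fix b assume b: "b \<in> {b. b \<in> S \<and> a dvd b} - {a}"
      then have "a < b" using pos by (auto dest!: dvd_imp_le)
      moreover have "b \<le> Max S" using b finS by simp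
      ultimately show "w b = 0" using b less.hyps[of b] by auto
    qed
    finally show ?case using W0[OF less.prems] by simp
  qed
qed

end

text \<open>The system is triangular: a new largest element \<open>b\<close> divides no earlier one,
  so the earlier equations persist and the value at \<open>b\<close> is free to satisfy its
  own.\<close>

lemma ex_dvd_summatory:
  fixes S :: "nat set" and f :: "nat \<Rightarrow> real"
  assumes "finite S" "\<And>a. a \<in> S \<Longrightarrow> a > 0"
  shows "\<exists>psi. \<forall>a\<in>S. sum psi {z\<in>S. z dvd a} = f a"
  using assms
proof (induction S rule: finite_linorder_max_induct)
  case empty
  then show ?case by simp
next
  case (insert b A)
  then obtain psi where psi: "\<forall>a\<in>A. sum psi {z\<in>A. z dvd a} = f a" by auto
  define psi' where "psi' = psi(b := f b - sum psi {z\<in>A. z dvd b})"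
  have bA: "b \<notin> A" using insert by auto
  have eq: "sum psi' {z\<in>A. z dvd a} = sum psi {z\<in>A. z dvd a}" for a
    using bA by (intro sum.cong) (auto simp: psi'_def)
  have "sum psi' {z\<in>insert b A. z dvd a} = f a" if "a \<in> insert b A" for a
  proof (cases "a = b")
    case True
    have "{z\<in>insert b A. z dvd b} = insert b {z\<in>A. z dvd b}" by auto
    then show ?thesis using True insert(1) bA eq by (simp add: psi'_def)
  next
    case False
    then have aA: "a \<in> A" using that by simp
    then have "\<not> b dvd a" using insert by (auto dest!: dvd_imp_le)
    then have "{z\<in>insert b A. z dvd a} = {z\<in>A. z dvd a}" by auto
    then show ?thesis using eq psi aA by simp
  qed
  then show ?case by blast
qed

lemma singular_lcm_matrixE:
  assumes "inj_on x {..<n}" "\<forall>i<n. 0 < x i" "singular_mat (lcm_matrix n x)"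
  obtains w b where "\<And>a. a \<in> x ` {..<n} \<Longrightarrow> (\<Sum>b\<in>x ` {..<n}. w b / real (gcd a b)) = 0"
    "b \<in> x ` {..<n}" "w b \<noteq> 0"
proof -
  have A: "lcm_matrix n x \<in> carrier_mat n n" by (simp add: lcm_matrix_def)
  obtain v where v: "v \<in> carrier_vec n" "v \<noteq> 0\<^sub>v n" "lcm_matrix n x *\<^sub>v v = 0\<^sub>v n"
    using det_0_iff_vec_prod_zero_field[OF A] assms(3) by (auto simp: singular_mat_def)
  \<comment> \<open>As \<open>lcm a b = a * b / gcd a b\<close>, dividing row \<open>i\<close> by
    \<open>x i\<close> and moving the factor \<open>x j\<close> into the kernel vector leaves the
    reciprocals of the gcds. The inverse of \<open>x\<close> indexes the result by elements of
    \<open>S\<close>.\<close>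
  define w where "w b = real b * v $ the_inv_into {..<n} x b" for b
  have wx: "w (x j) = real (x j) * v $ j" if "j < n" for j
    using that assms(1) by (simp add: w_def the_inv_into_f_f)
  have "(\<Sum>b\<in>x ` {..<n}. w b / real (gcd (x i) b)) = 0" if i: "i < n" for i
  proof -
    have "(\<Sum>b\<in>x ` {..<n}. w b / real (gcd (x i) b)) = (\<Sum>j<n. w (x j) / real (gcd (x i) (x j)))"
      using assms(1) by (simp add: sum.reindex)
    also have "\<dots> = (\<Sum>j<n. real (lcm (x i) (x j)) * v $ j / real (x i))"
    proof (intro sum.cong refl)
      fix j assume "j \<in> {..<n}"
      then have j: "j < n" by simp
      have "real (x i) * real (x j) = real (gcd (x i) (x j)) * real (lcm (x i) (x j))"
        by (metis of_nat_mult prod_gcd_lcm_nat)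
      moreover have "real (gcd (x i) (x j)) \<noteq> 0" "real (x i) \<noteq> 0" using assms(2) i j by auto
      ultimately show "w (x j) / real (gcd (x i) (x j))
          = real (lcm (x i) (x j)) * v $ j / real (x i)"
        by (simp add: wx[OF j] field_simps)
    qed
    also have "\<dots> = (lcm_matrix n x *\<^sub>v v) $ i / real (x i)"
      using i v(1)
      by (simp add: lcm_matrix_def scalar_prod_def sum_divide_distrib lessThan_atLeast0)
    finally show ?thesis using i v(3) by simp
  qed
  moreover obtain j where j: "j < n" "v $ j \<noteq> 0"
    using v(1,2) by (metis eq_vecI carrier_vecD index_zero_vec)
  then have "w (x j) \<noteq> 0" using wx assms(2) by auto
  ultimately show ?thesis using that[of w "x j"] j by auto
qed

section \<open>The cube as a lattice of subsets\<close>

text \<open>This order embedding into sets replaces the reflexive transitive closure by inclusions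
  that the simplifier can decide.\<close>

fun J8_atoms :: "J8 \<Rightarrow> nat set" where
  "J8_atoms J_b = {}"
| "J8_atoms J_a1 = {1}"
| "J8_atoms J_a2 = {2}"
| "J8_atoms J_a3 = {3}"
| "J8_atoms J_c1 = {1, 2}"
| "J8_atoms J_c2 = {1, 3}"
| "J8_atoms J_c3 = {2, 3}"
| "J8_atoms J_t = {1, 2, 3}"

lemma J8_le_iff: "J8_le u v \<longleftrightarrow> J8_atoms u \<subseteq> J8_atoms v"
proof
  assume "J8_le u v"
  then show "J8_atoms u \<subseteq> J8_atoms v"
    unfolding J8_le_def
  proof (induction rule: rtranclp_induct)
    case (step y z)
    from step(2) have "J8_atoms y \<subseteq> J8_atoms z" by cases auto
    with step(3) show ?case by blast
  qed simp
next
  assume "J8_atoms u \<subseteq> J8_atoms v"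
  note I = J8_covered_by.intros
  have up: "J8_le u v" if "J8_covered_by u w" "J8_le w v" for u w v
    using that unfolding J8_le_def by (rule converse_rtranclp_into_rtranclp)
  have refl: "J8_le u u" for u by (simp add: J8_le_def)
  \<comment> \<open>The 19 strict relations are listed by lower element: nine covers starting at
    some \<open>J_c\<close> or \<open>J_a\<close>, three chains from a \<open>J_a\<close> to
    \<open>J_t\<close>, and the seven relations above \<open>J_b\<close>.\<close>
  note c = I(10-12)[THEN up, OF refl] I(4-9)[THEN up, OF refl]
  note a = I(4)[THEN up, OF c(1)] I(5)[THEN up, OF c(1)] I(7)[THEN up, OF c(2)]
  note b = I(1-3)[THEN up, OF refl] I(1)[THEN up, OF c(4)] I(1)[THEN up, OF c(6)]
    I(2)[THEN up, OF c(8)] I(1)[THEN up, OF a(1)]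
  show "J8_le u v"
    using \<open>J8_atoms u \<subseteq> J8_atoms v\<close> by (cases u; cases v; simp add: refl a b c)
qed

theorem theorem4p1:
  fixes x :: "nat \<Rightarrow> nat" and S :: "nat set"
  assumes "inj_on x {..<8}"
    and "S = x ` {..<8}"
    and "\<forall>a\<in>S. 0 < a"
    and "gcd_closed S"
    and "singular_mat (lcm_matrix 8 x)"
  shows "order_isomorphic S (dvd) (UNIV :: J8 set) J8_le"
proof -
  have finS: "finite S" and cS: "card S = 8"
    using assms(1,2) by (simp_all add: card_image)
  obtain psi where "\<forall>a\<in>S. sum psi {z\<in>S. z dvd a} = 1 / real a"
    using ex_dvd_summatory[OF finS, of "\<lambda>a. 1 / real a"] assms(3) by blast
  then interpret gcd_closed_set S psi
    using finS assms(3,4) by unfold_locales (auto simp: gcd_closed_def)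
  obtain w d where "\<And>a. a \<in> S \<Longrightarrow> (\<Sum>b\<in>S. w b / real (gcd a b)) = 0" "d \<in> S" "w d \<noteq> 0"
    using singular_lcm_matrixE[OF assms(1) _ assms(5)] assms(2,3) by auto
  then obtain t where "t \<in> S" "psi t = 0"
    using zero_vector_if_psi_nonzero by metis
  then obtain a b c where abc: "distinct [a, b, c]" "dvd_antichain {a, b, c}" "cube_coatoms a b c"
    and S: "S = set [t, a, b, c, gcd a b, gcd a c, gcd b c, gcd (gcd a b) c]"
    and t: "a dvd t" "b dvd t" "c dvd t" "\<not> t dvd a" "\<not> t dvd b" "\<not> t dvd c"
    by (rule psi_eq_0_imp_cube) (use cS in simp)
  \<comment> \<open>The numbers \<open>a\<close>, \<open>b\<close>, \<open>c\<close> are the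
    coatoms, and each \<open>J_a\<close> is sent to the gcd of the two coatoms above it in the
    diagram.\<close>
  define f where "f u = (case u of J_b \<Rightarrow> gcd (gcd a b) c | J_a1 \<Rightarrow> gcd a b | J_a2 \<Rightarrow> gcd a c
    | J_a3 \<Rightarrow> gcd b c | J_c1 \<Rightarrow> a | J_c2 \<Rightarrow> b | J_c3 \<Rightarrow> c | J_t \<Rightarrow> t)" for u
  have nd: "\<not> a dvd b" "\<not> a dvd c" "\<not> b dvd a" "\<not> b dvd c" "\<not> c dvd a" "\<not> c dvd b"
    using abc(1,2) by (auto simp: dvd_antichain_def)
  have nd2: "\<not> gcd a b dvd c" "\<not> gcd a c dvd b" "\<not> gcd b c dvd a"
    using abc(3) by (simp_all add: cube_coatoms_def)
  have up: "gcd u v dvd z" if "u dvd z \<or> v dvd z" for u v z :: nat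
    using that by (auto intro: dvd_trans[OF gcd_dvd1] dvd_trans[OF gcd_dvd2])
  have iff: "f u dvd f v \<longleftrightarrow> J8_atoms u \<subseteq> J8_atoms v" for u v
    by (cases u; cases v; simp add: f_def t nd nd2 up)
  have inj: "inj f"
  proof (rule injI)
    fix u v assume "f u = f v"
    then have "J8_atoms u \<subseteq> J8_atoms v" "J8_atoms v \<subseteq> J8_atoms u"
      by (simp_all flip: iff)
    then show "u = v" by (cases u; cases v; simp)
  qed
  have "range f = S"
  proof -
    have U: "(UNIV :: J8 set) = {J_t, J_c1, J_c2, J_c3, J_a1, J_a2, J_a3, J_b}"
      using J8.exhaust by blast
    show ?thesis by (simp add: S U f_def)
  qed
  with inj have bij: "bij_betw f UNIV S" by (simp add: bij_betw_def)
  show ?thesis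
    unfolding order_isomorphic_def
  \<comment> \<open>The map \<open>f\<close> starts at \<open>J8\<close>, where cases are available;
    the required isomorphism starts at \<open>S\<close>, hence the inverse.\<close>
  proof (intro exI[of _ "inv_into UNIV f"] conjI ballI)
    show "bij_betw (inv_into UNIV f) S UNIV"
      using bij by (rule bij_betw_inv_into)
    fix u v assume "u \<in> S" "v \<in> S"
    then have "f (inv_into UNIV f u) = u" "f (inv_into UNIV f v) = v"
      using \<open>range f = S\<close> by (auto intro: f_inv_into_f)
    then show "u dvd v \<longleftrightarrow> J8_le (inv_into UNIV f u) (inv_into UNIV f v)"
      using iff[of "inv_into UNIV f u" "inv_into UNIV f v"] by (simp add: J8_le_iff)
  qed
qed

end
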